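(* For every integer $k \geq 2$, every nonzero rational number $q$, and every real number $\alpha$, $$\dim_{\mathrm{FS}}^{(k)}(q+\alpha) = \dim_{\mathrm{FS}}^{(k)}(q\alpha) = \dim_{\mathrm{FS}}^{(k)}(\alpha)$$ and $$\mathrm{Dim}_{\mathrm{FS}}^{(k)}(q+\alpha) = \mathrm{Dim}_{\mathrm{FS}}^{(k)}(q\alpha) = \mathrm{Dim}_{\mathrm{FS}}^{(k)}(\alpha).$$
   Context: Let $\Sigma=\{0,1,\ldots,k-1\}$. Sequences are elements of $\Sigma^\infty$, indexed from $0$; for a sequence $S$, $S[i..j]$ is the string of its $i$-th through $j$-th symbols. A base-$k$ expansion of $\beta\in[0,1]$ is a sequence $S$ with $\beta=\sum_{n\ge 0} S[n]k^{-(n+1)}$. All logarithms are base 2, and the Shannon entropy of a probability measure $\pi$ on a finite set $\Omega$ is $H(\pi)=\sum_{w\in\Omega}\pi(w)\log\frac{1}{\pi(w)}$ with $0\log\frac10=0$. For $S\in\Sigma^\infty$ and positive integers $l,n$, let $\pi^{(l)}_{S,n}$ be the probability measure on $\Sigma^l$ given by $\pi^{(l)}_{S,n}(w)=\frac1n\,|\{0\le j\le n-1 : S[jl..(j+1)l-1]=w\}|$ (the $n$-th block frequency of $w$). Define $H^-_l(S)=\frac{1}{l\log k}\liminf_{n\to\infty}H(\pi^{(l)}_{S,n})$ and $H^+_l(S)=\frac{1}{l\log k}\limsup_{n\to\infty}H(\pi^{(l)}_{S,n})$. The finite-state dimension of $S$ is $\dim_{\mathrm{FS}}(S)=\inf_{l\in\mathbb{Z}^+}H^-_l(S)$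 and the finite-state strong dimension is $\mathrm{Dim}_{\mathrm{FS}}(S)=\inf_{l\in\mathbb{Z}^+}H^+_l(S)$. For a real number $\alpha$, $\dim^{(k)}_{\mathrm{FS}}(\alpha)=\dim_{\mathrm{FS}}(S)$ and $\mathrm{Dim}^{(k)}_{\mathrm{FS}}(\alpha)=\mathrm{Dim}_{\mathrm{FS}}(S)$, where $S$ is a base-$k$ expansion of $\alpha-\lfloor\alpha\rfloor$ (this is well defined: when there are two expansions, both are eventually periodic and have strong dimension $0$). *)

theory Defs
  imports "HOL-Analysis.Analysis"
begin

definition blocks :: "nat \<Rightarrow> nat \<Rightarrow> nat list set" where
  "blocks k l = {w. length w = l \<and> set w \<subseteq> {..<k}}"

(* Isabelle's 1 / 0 = 0 is harmless here: the factor p w makes the summand 0 when p w = 0. *)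
definition shannon_entropy :: "'a set \<Rightarrow> ('a \<Rightarrow> real) \<Rightarrow> real" where
  "shannon_entropy \<Omega> p = (\<Sum>w\<in>\<Omega>. p w * log 2 (1 / p w))"

(* Meaningful for n > 0 only; the value at n = 0 does not affect the limits below. *)
definition block_freq :: "nat \<Rightarrow> (nat \<Rightarrow> nat) \<Rightarrow> nat \<Rightarrow> nat list \<Rightarrow> real" where
  "block_freq l S n w =
     real (card {j. j < n \<and> map S [j * l..<(j + 1) * l] = w}) / real n"

(* The limits inferior and superior, and the infima over l, are taken in the complete
   lattice ereal; for sequences over {..<k} with k \<ge> 2 and for l > 0 all values lie in [0, 1]. *)
definition lower_entropy_rate :: "nat \<Rightarrow> nat \<Rightarrow> (nat \<Rightarrow> nat) \<Rightarrow> ereal" where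
  "lower_entropy_rate k l S =
     ereal (1 / (real l * log 2 (real k))) *
     liminf (\<lambda>n. ereal (shannon_entropy (blocks k l) (block_freq l S n)))"

definition upper_entropy_rate :: "nat \<Rightarrow> nat \<Rightarrow> (nat \<Rightarrow> nat) \<Rightarrow> ereal" where
  "upper_entropy_rate k l S =
     ereal (1 / (real l * log 2 (real k))) *
     limsup (\<lambda>n. ereal (shannon_entropy (blocks k l) (block_freq l S n)))"

definition fs_dim_seq :: "nat \<Rightarrow> (nat \<Rightarrow> nat) \<Rightarrow> ereal" where
  "fs_dim_seq k S = (INF l\<in>{0<..}. lower_entropy_rate k l S)"

definition fs_strong_dim_seq :: "nat \<Rightarrow> (nat \<Rightarrow> nat) \<Rightarrow> ereal" where
  "fs_strong_dim_seq k S = (INF l\<in>{0<..}. upper_entropy_rate k l S)"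

definition is_base_expansion :: "nat \<Rightarrow> (nat \<Rightarrow> nat) \<Rightarrow> real \<Rightarrow> bool" where
  "is_base_expansion k S \<beta> \<longleftrightarrow>
     (\<forall>n. S n < k) \<and> (\<lambda>n. real (S n) / real k ^ (n + 1)) sums \<beta>"

lemma is_base_expansion_exists:
  fixes k :: nat and x :: real
  assumes k: "k \<ge> 2"
  shows "\<exists>S. is_base_expansion k S (frac x)"
proof -
  define b where "b = frac x"
  have b: "0 \<le> b" "b < 1" by (simp_all add: b_def frac_lt_1)
  define F where "F n = \<lfloor>real k ^ n * b\<rfloor>" for n
  define d where "d n = F (Suc n) - int k * F n" for n
  have kpos: "real k > 0" using k by simp
  have d0: "0 \<le> d n" for n
  proof -
    have "of_int (int k * F n) \<le> real k ^ Suc n * b"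
      using kpos of_int_floor_le[of "real k ^ n * b"] by (simp add: F_def mult.assoc)
    then have "int k * F n \<le> F (Suc n)" unfolding F_def by (subst le_floor_iff)
    then show ?thesis by (simp add: d_def)
  qed
  have dk: "d n < int k" for n
  proof -
    have "real k * (real k ^ n * b) < real k * (of_int (F n) + 1)"
      using kpos unfolding F_def by (intro mult_strict_left_mono) linarith+
    then have "real k ^ Suc n * b < of_int (int k * F n + int k)"
      by (simp add: algebra_simps)
    then have "F (Suc n) < int k * F n + int k" unfolding F_def by (subst floor_less_iff)
    then show ?thesis by (simp add: d_def)
  qed
  define S where "S n = nat (d n)" for n
  have S: "real (S n) = of_int (d n)" for n using d0[of n] by (simp add: S_def)
  have partial: "(\<Sum>n<N. real (S n) / real k ^ (n + 1)) = of_int (F N) / real k ^ N" for N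
  proof (induction N)
    case 0
    then show ?case using b by (simp add: F_def floor_eq_iff)
  next
    case (Suc N)
    then show ?case using kpos by (simp add: S d_def field_simps)
  qed
  have "(\<lambda>N. of_int (F N) / real k ^ N) \<longlonglongrightarrow> b"
  proof (rule real_tendsto_sandwich)
    have "(\<lambda>N. (1 / real k) ^ N) \<longlonglongrightarrow> 0"
      using k by (intro LIMSEQ_power_zero) (simp add: field_simps)
    from tendsto_diff[OF tendsto_const[of b] this]
    show "(\<lambda>N. b - (1 / real k) ^ N) \<longlonglongrightarrow> b" by simp
    show "\<forall>\<^sub>F N in sequentially. b - (1 / real k) ^ N \<le> of_int (F N) / real k ^ N"
    proof (intro always_eventually allI)
      fix N
      have "real k ^ N * b - 1 \<le> of_int (F N)" unfolding F_def by linarith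
      then have "(real k ^ N * b - 1) / real k ^ N \<le> of_int (F N) / real k ^ N"
        using kpos by (intro divide_right_mono) simp_all
      then show "b - (1 / real k) ^ N \<le> of_int (F N) / real k ^ N"
        using kpos by (simp add: diff_divide_distrib power_one_over)
    qed
    show "\<forall>\<^sub>F N in sequentially. of_int (F N) / real k ^ N \<le> b"
      using kpos by (intro always_eventually allI) (simp add: F_def divide_le_eq mult.commute)
    show "(\<lambda>N. b) \<longlonglongrightarrow> b" by simp
  qed
  then have "(\<lambda>n. real (S n) / real k ^ (n + 1)) sums b"
    unfolding sums_def partial .
  moreover have "S n < k" for n using d0[of n] dk[of n] by (simp add: S_def)
  ultimately show ?thesis unfolding is_base_expansion_def b_def by blast
qed

(* The choice of expansion is immaterial: a number with two expansions has only
   eventually constant ones, and these have dimension and strong dimension 0. *)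
definition base_expansion :: "nat \<Rightarrow> real \<Rightarrow> nat \<Rightarrow> nat" where
  "base_expansion k \<alpha> = (SOME S. is_base_expansion k S (frac \<alpha>))"

definition fs_dim :: "nat \<Rightarrow> real \<Rightarrow> ereal" where
  "fs_dim k \<alpha> = fs_dim_seq k (base_expansion k \<alpha>)"

definition fs_strong_dim :: "nat \<Rightarrow> real \<Rightarrow> ereal" where
  "fs_strong_dim k \<alpha> = fs_strong_dim_seq k (base_expansion k \<alpha>)"

end

theory Submission
  imports Defs
begin

text \<open>
  Suppose \<open>a * x + c = b * y\<close> with integers \<open>a, b \<noteq> 0\<close> and \<open>c\<close>. In long
  division, a length-\<open>l\<close> block of digits of \<open>y\<close> is determined by the corresponding block of \<open>x\<close>
  together with an incoming and an outgoing carry, both integers of absolute value at most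
  \<open>\<bar>a\<bar> + \<bar>b\<bar>\<close>. Hence the block entropies of \<open>x\<close> and \<open>y\<close> differ by a bound independent of \<open>l\<close>
  and of the number of blocks, which the normalisation \<open>1 / l\<close> kills as \<open>l\<close> grows. Subadditivity
  of entropy shows that passing from \<open>l\<close> to \<open>m * l\<close> does not increase the entropy rates, so the
  infima over \<open>l\<close> may be restricted to large \<open>l\<close>.
  All entropy bounds come from comparing the empirical distribution with a suitable
  subprobability \<open>q\<close> by Gibbs' inequality.
\<close>

section \<open>Empirical distributions, their entropy, and Gibbs' inequality\<close>

definition emp_freq :: "(nat \<Rightarrow> 'a) \<Rightarrow> nat \<Rightarrow> 'a \<Rightarrow> real" where
  "emp_freq s n w = real (card {j. j < n \<and> s j = w}) / real n"

text \<open>Averaging over positions instead of letters spares naming an alphabet, and every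
  frequency under the logarithm is positive.\<close>

definition emp_entropy :: "(nat \<Rightarrow> 'a) \<Rightarrow> nat \<Rightarrow> real" where
  "emp_entropy s n = (\<Sum>j<n. log 2 (1 / emp_freq s n (s j))) / real n"

lemma emp_freq_nonneg: "emp_freq s n w \<ge> 0"
  by (simp add: emp_freq_def)

lemma emp_freq_pos: "j < n \<Longrightarrow> emp_freq s n (s j) > 0"
  by (auto simp: emp_freq_def card_gt_0_iff intro!: divide_pos_pos)

lemma sum_emp_freq_mult:
  fixes g :: "'a \<Rightarrow> real"
  assumes "finite A" and "s ` {..<n} \<subseteq> A"
  shows "(\<Sum>w\<in>A. emp_freq s n w * g w) = (\<Sum>j<n. g (s j)) / real n"
proof -
  have "(\<Sum>j<n. g (s j)) = (\<Sum>w\<in>A. \<Sum>j\<in>{j\<in>{..<n}. s j = w}. g (s j))"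
    using assms by (subst sum.group) auto
  also have "\<dots> = (\<Sum>w\<in>A. real (card {j. j < n \<and> s j = w}) * g w)"
    by (intro sum.cong refl) simp
  finally show ?thesis
    by (simp add: emp_freq_def sum_divide_distrib)
qed

lemma sum_emp_freq:
  assumes "finite A" and "s ` {..<n} \<subseteq> A" and "n > 0"
  shows "sum (emp_freq s n) A = 1"
  using sum_emp_freq_mult[OF assms(1,2), of "\<lambda>_. 1"] assms(3) by simp

lemma shannon_entropy_emp_freq:
  assumes "finite A" and "s ` {..<n} \<subseteq> A"
  shows "shannon_entropy A (emp_freq s n) = emp_entropy s n"
  unfolding shannon_entropy_def emp_entropy_def by (rule sum_emp_freq_mult[OF assms])

text \<open>Gibbs' inequality: apply \<open>ln x <= x - 1\<close> to the ratio of \<open>q\<close>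
  to the empirical frequency and average over the positions.\<close>

lemma emp_entropy_le_cross_entropy:
  fixes q :: "'a \<Rightarrow> real"
  assumes pos: "\<And>j. j < n \<Longrightarrow> q (s j) > 0" and le1: "sum q (s ` {..<n}) \<le> 1"
  shows "emp_entropy s n \<le> (\<Sum>j<n. log 2 (1 / q (s j))) / real n"
proof (cases "n = 0")
  case False
  let ?p = "emp_freq s n"
  have diff_le: "log 2 (1 / ?p (s j)) - log 2 (1 / q (s j)) \<le> (q (s j) / ?p (s j) - 1) / ln 2"
    if "j < n" for j
  proof -
    have "log 2 (1 / ?p (s j)) - log 2 (1 / q (s j)) = ln (q (s j) / ?p (s j)) / ln 2"
      using pos[OF that] emp_freq_pos[OF that, of s]
      by (simp add: log_def ln_div diff_divide_distrib[symmetric])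
    also have "\<dots> \<le> (q (s j) / ?p (s j) - 1) / ln 2"
      using pos[OF that] emp_freq_pos[OF that, of s]
      by (intro divide_right_mono ln_le_minus_one) simp_all
    finally show ?thesis .
  qed
  \<comment> \<open>Grouping the positions by letter cancels the frequencies: the average of the
    ratios is the \<open>q\<close>-mass of the letters that occur.\<close>
  have "(\<Sum>j<n. q (s j) / ?p (s j)) / real n = (\<Sum>w\<in>s ` {..<n}. ?p w * (q w / ?p w))"
    by (subst sum_emp_freq_mult) auto
  also have "\<dots> = sum q (s ` {..<n})"
  proof (intro sum.cong refl)
    fix w assume "w \<in> s ` {..<n}"
    then have "?p w > 0" using emp_freq_pos[of _ n s] by auto
    then show "?p w * (q w / ?p w) = q w" by simp
  qed
  finally have "(\<Sum>j<n. q (s j) / ?p (s j)) \<le> real n"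
    using le1 False by (simp add: divide_simps split: if_splits)
  then have "(\<Sum>j<n. (q (s j) / ?p (s j) - 1) / ln 2) \<le> 0"
    by (simp add: sum_divide_distrib[symmetric] sum_subtractf divide_le_0_iff)
  moreover have "(\<Sum>j<n. log 2 (1 / ?p (s j)) - log 2 (1 / q (s j)))
      \<le> (\<Sum>j<n. (q (s j) / ?p (s j) - 1) / ln 2)"
    using diff_le by (intro sum_mono) simp
  ultimately show ?thesis
    by (auto simp: emp_entropy_def sum_subtractf intro!: divide_right_mono)
qed (simp add: emp_entropy_def)

text \<open>If each value of \<open>s\<close> is accompanied by at most \<open>D\<close> values of
  \<open>t\<close>, then \<open>s\<close> together with one of \<open>D\<close> labels determines
  \<open>t\<close>, and the labels cost at most \<open>log 2 D\<close>.\<close>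

lemma emp_entropy_le_fiber:
  fixes s :: "nat \<Rightarrow> 'a" and t :: "nat \<Rightarrow> 'b"
  assumes D: "D \<ge> 1"
    and fin: "\<And>w. finite (t ` {j. s j = w})"
    and card: "\<And>w. card (t ` {j. s j = w}) \<le> D"
  shows "emp_entropy t n \<le> emp_entropy s n + log 2 (real D)"
proof (cases "n = 0")
  case True
  then show ?thesis using D by (simp add: emp_entropy_def)
next
  case False
  let ?p = "emp_freq s n" and ?R = "\<lambda>w. t ` {j. s j = w}"
  \<comment> \<open>Each value \<open>x\<close> of \<open>s\<close> gives the share
    \<open>?p x / D\<close> to every value of \<open>t\<close> that accompanies it. There are at
    most \<open>D\<close> of these, so the total mass is at most 1.\<close>
  define q where
    "q y = (\<Sum>x\<in>s ` {..<n}. if y \<in> ?R x then ?p x / real D else 0)" for y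
  have q_ge: "?p (s j) / real D \<le> q (t j)" if "j < n" for j
  proof -
    have "(if t j \<in> ?R (s j) then ?p (s j) / real D else 0) \<le> q (t j)"
      unfolding q_def using that by (intro member_le_sum) (auto simp: emp_freq_nonneg)
    then show ?thesis by (auto split: if_splits)
  qed
  have q_pos: "q (t j) > 0" if "j < n" for j
    using q_ge[OF that] emp_freq_pos[OF that, of s] D
    by (smt (verit) divide_pos_pos of_nat_0_less_iff not_one_le_zero of_nat_le_0_iff)
  have "sum q (t ` {..<n})
      = (\<Sum>x\<in>s ` {..<n}. \<Sum>y\<in>t ` {..<n}. if y \<in> ?R x then ?p x / real D else 0)"
    unfolding q_def by (rule sum.swap)
  also have "\<dots> = (\<Sum>x\<in>s ` {..<n}. real (card (t ` {..<n} \<inter> ?R x)) * (?p x / real D))"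
    by (intro sum.cong refl) (simp add: sum.If_cases)
  also have "\<dots> \<le> sum ?p (s ` {..<n})"
  proof (intro sum_mono)
    fix x
    have "card (t ` {..<n} \<inter> ?R x) \<le> D"
      using card_mono[OF fin[of x], of "t ` {..<n} \<inter> ?R x"] card[of x] by auto
    then have "real (card (t ` {..<n} \<inter> ?R x)) * (?p x / real D) \<le> real D * (?p x / real D)"
      by (intro mult_right_mono) (auto simp: emp_freq_nonneg)
    then show "real (card (t ` {..<n} \<inter> ?R x)) * (?p x / real D) \<le> ?p x"
      using D by simp
  qed
  also have "\<dots> = 1" using False by (intro sum_emp_freq) auto
  finally have "emp_entropy t n \<le> (\<Sum>j<n. log 2 (1 / q (t j))) / real n"
    using q_pos by (intro emp_entropy_le_cross_entropy) auto
  also have "\<dots> \<le> (\<Sum>j<n. log 2 (1 / ?p (s j)) + log 2 (real D)) / real n"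
  proof (intro divide_right_mono sum_mono)
    fix j assume "j \<in> {..<n}"
    then have j: "j < n" by simp
    have "log 2 (1 / q (t j)) \<le> log 2 (1 / ?p (s j) * real D)"
      using q_ge[OF j] q_pos[OF j] emp_freq_pos[OF j, of s] D by (simp add: field_simps)
    also have "\<dots> = log 2 (1 / ?p (s j)) + log 2 (real D)"
      using emp_freq_pos[OF j, of s] D by (intro log_mult_pos) simp_all
    finally show "log 2 (1 / q (t j)) \<le> log 2 (1 / ?p (s j)) + log 2 (real D)" .
  qed simp
  also have "\<dots> = emp_entropy s n + log 2 (real D)"
    using False by (simp add: emp_entropy_def sum.distrib add_divide_distrib)
  finally show ?thesis .
qed

text \<open>Expanding the power gives one product per word. For a probability \<open>q\<close> this
  says that the product measure on words of length \<open>m\<close> has mass 1.\<close>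

lemma sum_prod_list_map:
  fixes q :: "'a \<Rightarrow> real"
  assumes "finite A"
  shows "(\<Sum>w | set w \<subseteq> A \<and> length w = m. prod_list (map q w)) = sum q A ^ m"
proof (induction m)
  case 0
  have "{w. set w \<subseteq> A \<and> length w = 0} = {[]}" by auto
  then show ?case by simp
next
  case (Suc m)
  let ?L = "{w. set w \<subseteq> A \<and> length w = m}"
  have "(\<Sum>w | set w \<subseteq> A \<and> length w = Suc m. prod_list (map q w))
      = (\<Sum>(w, x)\<in>?L \<times> A. q x * prod_list (map q w))"
    unfolding lists_length_Suc_eq
    by (subst sum.reindex) (auto simp: inj_on_def case_prod_unfold)
  also have "\<dots> = (\<Sum>w\<in>?L. \<Sum>x\<in>A. q x * prod_list (map q w))"
    by (rule sum.cartesian_product[symmetric])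
  also have "\<dots> = sum q A * (\<Sum>w\<in>?L. prod_list (map q w))"
    by (simp add: sum_distrib_left sum_distrib_right)
  finally show ?case using Suc.IH by simp
qed

lemma log_inverse_prod_list:
  assumes "\<And>x. x \<in> set xs \<Longrightarrow> (q x :: real) > 0"
  shows "prod_list (map q xs) > 0 \<and>
    log 2 (1 / prod_list (map q xs)) = (\<Sum>x\<leftarrow>xs. log 2 (1 / q x))"
  using assms by (induction xs) (auto simp: log_divide_pos log_mult_pos)

text \<open>
  Comparing with the product measure of the letter frequencies of the longer stretch \<open>n'\<close> avoids any
  continuity argument for the letters left over when \<open>m\<close> does not divide \<open>n'\<close>.
\<close>
lemma emp_entropy_blocks_le:
  fixes s :: "nat \<Rightarrow> 'a"
  assumes nm: "n * m \<le> n'" and "n > 0" and "m > 0"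
  shows "emp_entropy (\<lambda>j. map s [j * m..<(j + 1) * m]) n
    \<le> (real n' / real n) * emp_entropy s n'"
proof -
  let ?u = "\<lambda>j. map s [j * m..<(j + 1) * m]" and ?p = "emp_freq s n'"
  let ?g = "\<lambda>j. log 2 (1 / ?p (s j))"
  have lt: "i < n'" if "j < n" "i < (j + 1) * m" for i j
  proof -
    have "(j + 1) * m \<le> n * m" using that by (intro mult_right_mono) auto
    then show ?thesis using that nm by linarith
  qed
  have n': "n' > 0" using assms by (cases n') auto
  have *: "prod_list (map ?p (?u j)) > 0 \<and>
      log 2 (1 / prod_list (map ?p (?u j))) = (\<Sum>x\<leftarrow>?u j. log 2 (1 / ?p x))"
    if "j < n" for j
    using lt[OF that] by (intro log_inverse_prod_list) (auto intro!: emp_freq_pos)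
  have "(\<Sum>w\<in>?u ` {..<n}. prod_list (map ?p w))
      \<le> (\<Sum>w | set w \<subseteq> s ` {..<n'} \<and> length w = m. prod_list (map ?p w))"
    using lt by (intro sum_mono2 finite_lists_length_eq)
      (auto intro!: prod_list_nonneg simp: emp_freq_nonneg)
  also have "\<dots> = 1"
    using n' by (subst sum_prod_list_map) (auto simp: sum_emp_freq)
  finally have "emp_entropy ?u n \<le> (\<Sum>j<n. log 2 (1 / prod_list (map ?p (?u j)))) / real n"
    using * by (intro emp_entropy_le_cross_entropy) auto
  also have "(\<Sum>j<n. log 2 (1 / prod_list (map ?p (?u j)))) = (\<Sum>j<n. \<Sum>i\<in>{j*m..<j*m+m}. ?g i)"
    using * by (intro sum.cong refl) (simp add: sum_list_distinct_conv_sum_set o_def add.commute)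
  also have "\<dots> = (\<Sum>i<n * m. ?g i)"
    by (rule sum.nat_group)
  \<comment> \<open>The positions left over contribute nonnegative terms, since frequencies are at
    most 1.\<close>
  also have "\<dots> \<le> (\<Sum>i<n'. ?g i)"
  proof (intro sum_mono2)
    fix i assume "i \<in> {..<n'} - {..<n * m}"
    then have i: "i < n'" by simp
    have "?p (s i) \<le> 1"
      using sum_emp_freq[of "s ` {..<n'}" s n'] n' i
        member_le_sum[of "s i" "s ` {..<n'}" ?p] by (auto simp: emp_freq_nonneg)
    then show "0 \<le> ?g i" using emp_freq_pos[OF i, of s] by simp
  qed (use nm in auto)
  also have "\<dots> / real n = (real n' / real n) * emp_entropy s n'"
    using n' by (simp add: emp_entropy_def)
  finally show ?thesis by (simp add: divide_right_mono)
qed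

section \<open>Values of digit words and of tails of expansions\<close>

primrec horner :: "nat \<Rightarrow> int \<Rightarrow> nat list \<Rightarrow> int" where
  "horner k v [] = v"
| "horner k v (d # ds) = horner k (int k * v + int d) ds"

abbreviation word_value :: "nat \<Rightarrow> nat list \<Rightarrow> int" where
  "word_value k \<equiv> horner k 0"

lemma horner_append: "horner k v (ds @ es) = horner k (horner k v ds) es"
  by (induction ds arbitrary: v) auto

text \<open>The last digit is the remainder of the value modulo \<open>k\<close>, so digits can be
  recovered from the right.\<close>

lemma word_value_inject:
  assumes "length v = length w" and "set v \<subseteq> {..<k}" and "set w \<subseteq> {..<k}"
    and "word_value k v = word_value k w"
  shows "v = w"
  using assms
proof (induction v arbitrary: w rule: rev_induct)
  case (snoc d v)
  obtain e w' where w: "w = w' @ [e]"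
    using snoc.prems(1) by (cases w rule: rev_cases) auto
  have de: "d < k" "e < k" using snoc.prems w by auto
  have eq: "int k * word_value k v + int d = int k * word_value k w' + int e"
    using snoc.prems(4) by (simp add: w horner_append)
  have "(int k * word_value k v + int d) mod int k = int d"
    "(int k * word_value k w' + int e) mod int k = int e"
    using de by simp_all
  then have "d = e" using eq by simp
  then show ?case using snoc.IH[of w'] snoc.prems eq w de by auto
qed simp

text \<open>The number left after deleting the first \<open>N\<close> digits. It can equal 1, when
  all remaining digits are \<open>k - 1\<close>, so it need not be a fractional part.\<close>

definition tail_value :: "nat \<Rightarrow> (nat \<Rightarrow> nat) \<Rightarrow> nat \<Rightarrow> real" where
  "tail_value k S N = (\<Sum>i. real (S (N + i)) / real k ^ (i + 1))"

context
  fixes k :: nat and S :: "nat \<Rightarrow> nat"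
  assumes k: "k \<ge> 2" and digits: "\<And>n. S n < k"
begin

text \<open>The series with every digit equal to \<open>k - 1\<close> dominates all expansions: it
  yields both summability and the upper bound 1 for tails.\<close>

lemma max_digits_sums: "(\<lambda>i. (real k - 1) / real k ^ (i + 1)) sums 1"
proof -
  have "(\<lambda>i. (real k - 1) / real k * (1 / real k) ^ i) sums ((real k - 1) / real k * (1 / (1 - 1 / real k)))"
    using k by (intro sums_mult geometric_sums) simp
  also have "(real k - 1) / real k * (1 / (1 - 1 / real k)) = 1"
    using k by (simp add: field_simps)
  finally show ?thesis by (simp add: power_one_over)
qed

lemma digit_term_le: "real (S n) / real k ^ i \<le> (real k - 1) / real k ^ i"
  using digits[of n] by (intro divide_right_mono) auto

lemma tail_summable: "summable (\<lambda>i. real (S (N + i)) / real k ^ (i + 1))"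
  using digit_term_le
  by (intro summable_comparison_test'[OF sums_summable[OF max_digits_sums]]) (auto simp del: power_Suc)

lemma tail_value_bounds: "0 \<le> tail_value k S N" "tail_value k S N \<le> 1"
proof -
  show "0 \<le> tail_value k S N"
    unfolding tail_value_def by (intro suminf_nonneg tail_summable) auto
  show "tail_value k S N \<le> 1"
    unfolding tail_value_def using digit_term_le
    by (subst sums_unique[OF max_digits_sums]) (intro suminf_le tail_summable sums_summable[OF max_digits_sums])
qed

lemma tail_value_Suc: "real k * tail_value k S N = real (S N) + tail_value k S (Suc N)"
proof -
  have "tail_value k S N = real (S N) / real k + (\<Sum>i. real (S (N + Suc i)) / real k ^ (Suc i + 1))"
    unfolding tail_value_def using suminf_split_head[OF tail_summable[of N]] by simp
  also have "(\<Sum>i. real (S (N + Suc i)) / real k ^ (Suc i + 1)) = tail_value k S (Suc N) / real k"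
    unfolding tail_value_def
    by (subst suminf_divide[OF tail_summable, symmetric]) (simp add: field_simps)
  finally show ?thesis using k by (simp add: field_simps)
qed

text \<open>This is how a block of digits enters a linear relation: as the integer separating a
  scaled tail from a later tail.\<close>

lemma tail_value_split:
  "real k ^ l * tail_value k S N
    = of_int (word_value k (map S [N..<N + l])) + tail_value k S (N + l)"
proof (induction l)
  case (Suc l)
  have "real k ^ Suc l * tail_value k S N = real k * (real k ^ l * tail_value k S N)"
    by simp
  then show ?case using tail_value_Suc[of "N + l"]
    by (simp only: Suc.IH) (simp add: horner_append algebra_simps)
qed simp

end

lemma base_expansion_tail_value:
  assumes "is_base_expansion k S \<beta>"
  shows "tail_value k S 0 = \<beta>"
  using assms by (simp add: is_base_expansion_def tail_value_def sums_iff)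

section \<open>Carries and the number of blocks compatible with a given block\<close>

definition block_seq :: "nat \<Rightarrow> (nat \<Rightarrow> nat) \<Rightarrow> nat \<Rightarrow> nat list" where
  "block_seq l S j = map S [j * l..<(j + 1) * l]"

lemma bounded_int_of_affine_combination:
  fixes a b i :: int and x y :: real
  assumes "of_int i = of_int b * y - of_int a * x"
    and "0 \<le> x" "x \<le> 1" "0 \<le> y" "y \<le> 1"
  shows "\<bar>i\<bar> \<le> \<bar>a\<bar> + \<bar>b\<bar>"
proof -
  have "\<bar>of_int b * y - of_int a * x\<bar> \<le> \<bar>of_int b\<bar> * \<bar>y\<bar> + \<bar>of_int a\<bar> * \<bar>x\<bar>"
    by (simp add: abs_mult[symmetric] abs_triangle_ineq4)
  also have "\<dots> \<le> \<bar>of_int b\<bar> * 1 + \<bar>of_int a\<bar> * 1"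
    using assms by (intro add_mono mult_left_mono) auto
  finally have "\<bar>of_int i :: real\<bar> \<le> of_int (\<bar>a\<bar> + \<bar>b\<bar>)" using assms(1) by simp
  then show ?thesis by linarith
qed

text \<open>The carry at position \<open>N\<close> is \<open>b\<close> times the tail of
  \<open>T\<close> minus \<open>a\<close> times the tail of \<open>S\<close>. Given the block
  \<open>w\<close> of \<open>S\<close>, the carries at both ends of the block fix \<open>b\<close>
  times the value of the block of \<open>T\<close>, and this fixes that block because
  \<open>b\<close> is nonzero.\<close>

lemma block_fiber_card:
  fixes a b c :: int
  assumes k: "k \<ge> 2" and b: "b \<noteq> 0"
    and S: "is_base_expansion k S x" and T: "is_base_expansion k T y"
    and rel: "of_int a * x + of_int c = of_int b * y"
  defines "M \<equiv> \<bar>a\<bar> + \<bar>b\<bar>"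
  shows "finite (block_seq l T ` {j. block_seq l S j = w})"
    and "card (block_seq l T ` {j. block_seq l S j = w}) \<le> card ({-M..M} \<times> {-M..M})"
proof -
  let ?Y = "block_seq l T ` {j. block_seq l S j = w}"
  let ?V = "(\<lambda>(i, e). a * word_value k w + i * int k ^ l + e) ` ({-M..M} \<times> {-M..M})"
  have SD: "S n < k" and TD: "T n < k" for n
    using S T by (auto simp: is_base_expansion_def)
  note s_split = tail_value_split[of k S, OF k SD] and t_split = tail_value_split[of k T, OF k TD]
  note bounds = tail_value_bounds[of k S, OF k SD] tail_value_bounds[of k T, OF k TD]
  have carry: "\<exists>i. \<bar>i\<bar> \<le> M \<and>
      of_int i = of_int b * tail_value k T N - of_int a * tail_value k S N" for N
  proof -
    \<comment> \<open>Multiply the relation by \<open>k ^ N\<close> and remove the integers formed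
      by the first \<open>N\<close> digits on both sides; what remains is this integer.\<close>
    define i where "i = c * int k ^ N + a * word_value k (map S [0..<N]) - b * word_value k (map T [0..<N])"
    have "of_int a * (real k ^ N * x) + of_int c * real k ^ N = real k ^ N * (of_int a * x + of_int c)"
      by (simp add: algebra_simps)
    also have "\<dots> = of_int b * (real k ^ N * y)"
      by (simp only: rel mult.left_commute)
    finally have "of_int a * (real k ^ N * tail_value k S 0) + of_int c * real k ^ N
        = of_int b * (real k ^ N * tail_value k T 0)"
      by (simp only: base_expansion_tail_value[OF S] base_expansion_tail_value[OF T])
    then have "of_int i = of_int b * tail_value k T N - of_int a * tail_value k S N"
      unfolding s_split t_split by (simp add: i_def algebra_simps)
    then show ?thesis unfolding M_def
      using bounded_int_of_affine_combination bounds by blast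
  qed
  have img: "(\<lambda>v. b * word_value k v) ` ?Y \<subseteq> ?V"
  proof clarify
    fix j assume w: "w = block_seq l S j"
    obtain i e where i: "\<bar>i\<bar> \<le> M"
        "of_int i = of_int b * tail_value k T (j * l) - of_int a * tail_value k S (j * l)"
      and e: "\<bar>e\<bar> \<le> M"
        "of_int e = of_int b * tail_value k T (j * l + l) - of_int a * tail_value k S (j * l + l)"
      using carry[of "j * l"] carry[of "j * l + l"] by auto
    have "real k ^ l * of_int i = of_int b * (real k ^ l * tail_value k T (j * l))
        - of_int a * (real k ^ l * tail_value k S (j * l))"
      by (simp add: i(2) algebra_simps)
    then have "real_of_int (b * word_value k (block_seq l T j))
        = of_int (a * word_value k w + i * int k ^ l + (- e))"
      unfolding s_split t_split w block_seq_def by (simp add: e(2) algebra_simps)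
    then have "b * word_value k (block_seq l T j) = a * word_value k w + i * int k ^ l + (- e)"
      by (simp only: of_int_eq_iff)
    then show "b * word_value k (block_seq l T j) \<in>
        (\<lambda>(i, e). a * word_value k (block_seq l S j) + i * int k ^ l + e) ` ({-M..M} \<times> {-M..M})"
      \<comment> \<open>The outgoing carry enters with a minus sign; the range of carries is
        symmetric, so \<open>- e\<close> is admissible.\<close>
      using i(1) e(1) by (intro image_eqI[of _ _ "(i, - e)"]) (auto simp: w)
  qed
  have inj: "inj_on (\<lambda>v. b * word_value k v) ?Y"
    using b TD by (auto intro!: inj_onI word_value_inject simp: block_seq_def)
  have fin: "finite ?V" by (intro finite_imageI) simp
  show "finite ?Y" using inj_on_finite[OF inj img fin] .
  show "card ?Y \<le> card ({-M..M} \<times> {-M..M})"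
    using card_inj_on_le[OF inj img fin] by (rule order_trans) (intro card_image_le, simp)
qed

section \<open>Entropy along multiples of the block length\<close>

lemma shannon_entropy_block_freq:
  assumes "\<And>n. S n < k"
  shows "shannon_entropy (blocks k l) (block_freq l S n) = emp_entropy (block_seq l S) n"
proof -
  have "block_freq l S n = emp_freq (block_seq l S) n"
    by (auto simp: block_freq_def emp_freq_def block_seq_def)
  moreover have "finite (blocks k l)"
    using finite_lists_length_eq[of "{..<k}" l] by (simp add: blocks_def conj_commute)
  ultimately show ?thesis
    using assms by (auto simp: blocks_def block_seq_def intro!: shannon_entropy_emp_freq)
qed

lemma block_seq_concat:
  "concat (map (block_seq l S) [a..<a + m]) = map S [a * l..<(a + m) * l]"
proof (induction m)
  case (Suc m)
  have "[a * l..<(a + Suc m) * l] = [a * l..<(a + m) * l] @ [(a + m) * l..<(a + Suc m) * l]"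
    using upt_add_eq_append[of "a * l" "(a + m) * l" l] by (simp add: algebra_simps)
  then show ?case using Suc.IH by (simp add: block_seq_def)
qed simp

text \<open>A block of length \<open>m * l\<close> is the concatenation of \<open>m\<close>
  consecutive blocks of length \<open>l\<close>, hence a function of the word of these blocks.
  Passing to a function of a sequence is the fiber bound with \<open>D = 1\<close>.\<close>

lemma emp_entropy_long_blocks_le:
  assumes "n * m \<le> n'" and "n > 0" and "m > 0"
  shows "emp_entropy (block_seq (m * l) S) n
    \<le> (real n' / real n) * emp_entropy (block_seq l S) n'"
proof -
  let ?u = "\<lambda>j. map (block_seq l S) [j * m..<(j + 1) * m]"
  have "block_seq (m * l) S j = concat (?u j)" for j
    using block_seq_concat[of l S "j * m" m] by (simp add: block_seq_def algebra_simps)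
  then have sub: "block_seq (m * l) S ` {j. ?u j = w} \<subseteq> {concat w}" for w
    by auto
  have "emp_entropy (block_seq (m * l) S) n \<le> emp_entropy ?u n + log 2 (real 1)"
    using card_mono[OF _ sub] finite_subset[OF sub] by (intro emp_entropy_le_fiber) auto
  also have "emp_entropy ?u n \<le> (real n' / real n) * emp_entropy (block_seq l S) n'"
    using assms by (rule emp_entropy_blocks_le)
  finally show ?thesis by simp
qed

text \<open>A property that holds eventually along \<open>G\<close> holds eventually for
  \<open>f n\<close>. No monotonicity of \<open>f\<close> enters, so it covers
  \<open>n div m\<close>, which repeats each value.\<close>

lemma Liminf_le_Liminf_compose:
  fixes X :: "'a \<Rightarrow> 'b::complete_lattice"
  assumes "filterlim f G F"
  shows "Liminf G X \<le> Liminf F (\<lambda>n. X (f n))"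
  unfolding Liminf_def
proof (intro SUP_mono, safe)
  fix P assume "eventually P G"
  then have "eventually (\<lambda>n. P (f n)) F"
    using assms by (simp add: filterlim_iff)
  moreover have "Inf (X ` Collect P) \<le> (INF n\<in>{n. P (f n)}. X (f n))"
    by (intro INF_greatest INF_lower) simp
  ultimately show "\<exists>Q\<in>{Q. eventually Q F}. Inf (X ` Collect P) \<le> (INF n\<in>Collect Q. X (f n))"
    by (intro bexI[of _ "\<lambda>n. P (f n)"]) simp_all
qed

text \<open>Sampling short blocks only at multiples of \<open>m\<close> could raise their liminf.
  Hence every \<open>n\<close> is compared with \<open>n div m\<close> long blocks, and the factor
  \<open>n / (n div m)\<close> tends to \<open>m\<close>.\<close>

lemma liminf_emp_entropy_long_blocks:
  assumes m: "m > 0"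
  shows "liminf (\<lambda>n. ereal (emp_entropy (block_seq (m * l) S) n))
    \<le> ereal (real m) * liminf (\<lambda>n. ereal (emp_entropy (block_seq l S) n))"
proof -
  let ?f = "\<lambda>n. ereal (emp_entropy (block_seq (m * l) S) n)"
    and ?g = "\<lambda>n. ereal (emp_entropy (block_seq l S) n)"
  have lim: "filterlim (\<lambda>n. n div m) at_top at_top"
    using m by (intro filterlim_at_top[THEN iffD2] allI)
      (auto simp: eventually_at_top_linorder less_eq_div_iff_mult_less_eq)
  have pos: "eventually (\<lambda>n. n div m > 0) sequentially"
    using filterlim_at_top[THEN iffD1, OF lim, rule_format, of 1] by (simp add: Suc_le_eq)
  have "filterlim (\<lambda>n. real (n div m)) at_top sequentially"
    using filterlim_compose[OF filterlim_real_sequentially lim] .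
  then have "(\<lambda>n. real m / real (n div m)) \<longlonglongrightarrow> 0"
    by (rule real_tendsto_divide_at_top[OF tendsto_const])
  moreover have "eventually (\<lambda>n. norm (real n / real (n div m) - real m) \<le> real m / real (n div m)) sequentially"
    using pos
  proof eventually_elim
    case (elim n)
    have "real n = real m * real (n div m) + real (n mod m)"
      by (metis mult_div_mod_eq of_nat_add of_nat_mult)
    then have "real n / real (n div m) - real m = real (n mod m) / real (n div m)"
      using elim by (simp add: field_simps)
    then show ?case
      using m by (simp add: divide_right_mono order_less_imp_le)
  qed
  ultimately have "(\<lambda>n. real n / real (n div m) - real m) \<longlonglongrightarrow> 0"
    by (rule Lim_null_comparison[rotated])
  then have quot: "(\<lambda>n. ereal (real n / real (n div m))) \<longlonglongrightarrow> ereal (real m)"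
    by (simp add: LIM_zero_iff)
  have "liminf ?f \<le> liminf (\<lambda>n. ?f (n div m))"
    using lim by (rule Liminf_le_Liminf_compose)
  also have "\<dots> \<le> liminf (\<lambda>n. ereal (real n / real (n div m)) * ?g n)"
  proof (intro Liminf_mono)
    from pos show "eventually (\<lambda>n. ?f (n div m) \<le> ereal (real n / real (n div m)) * ?g n) sequentially"
    proof eventually_elim
      case (elim n)
      then show ?case
        using emp_entropy_long_blocks_le[of "n div m" m n l S] m by simp
    qed
  qed
  also have "\<dots> = ereal (real m) * liminf ?g"
    using m by (intro ereal_liminf_lim_mult quot) auto
  finally show ?thesis .
qed

text \<open>Here sampling at the multiples \<open>n * m\<close> suffices, as a subsequence has no
  larger limsup.\<close>

lemma limsup_emp_entropy_long_blocks:
  assumes m: "m > 0"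
  shows "limsup (\<lambda>n. ereal (emp_entropy (block_seq (m * l) S) n))
    \<le> ereal (real m) * limsup (\<lambda>n. ereal (emp_entropy (block_seq l S) n))"
proof -
  let ?f = "\<lambda>n. ereal (emp_entropy (block_seq (m * l) S) n)"
    and ?g = "\<lambda>n. ereal (emp_entropy (block_seq l S) n)"
  have "limsup ?f \<le> limsup (\<lambda>n. ereal (real m) * (?g \<circ> (\<lambda>n. n * m)) n)"
  proof (intro Limsup_mono eventually_mono[OF eventually_gt_at_top[of 0]])
    fix n :: nat assume "n > 0"
    then show "?f n \<le> ereal (real m) * (?g \<circ> (\<lambda>n. n * m)) n"
      using emp_entropy_long_blocks_le[of n m "n * m" l S] m by simp
  qed
  also have "\<dots> = ereal (real m) * limsup (?g \<circ> (\<lambda>n. n * m))"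
    by (rule limsup_ereal_mult_left) simp
  also have "\<dots> \<le> ereal (real m) * limsup ?g"
    using m by (intro ereal_mult_left_mono limsup_subseq_mono) (auto simp: strict_mono_def)
  finally show ?thesis .
qed

text \<open>For fixed \<open>l\<close> the error \<open>C l / m\<close> vanishes as \<open>m\<close>
  grows, so the infimum of \<open>g\<close> lies below every \<open>f l\<close>.\<close>

lemma INF_le_INF_of_multiples:
  fixes f g :: "nat \<Rightarrow> ereal"
  assumes "\<And>m l. m > 0 \<Longrightarrow> l > 0 \<Longrightarrow> g (m * l) \<le> f l + ereal (C l / real m)"
  shows "(INF l\<in>{0<..}. g l) \<le> (INF l\<in>{0<..}. f l)"
proof (intro INF_greatest)
  fix l :: nat assume "l \<in> {0<..}"
  then have l: "l > 0" by simp
  show "(INF l\<in>{0<..}. g l) \<le> f l"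
  proof (rule ereal_le_epsilon2)
    fix e :: real assume e: "e > 0"
    \<comment> \<open>The absolute value keeps the threshold nonnegative, which forces
      \<open>m\<close> to be positive whatever the sign of \<open>C l\<close>.\<close>
    obtain m :: nat where m: "\<bar>C l\<bar> / e < real m" using reals_Archimedean2[of "\<bar>C l\<bar> / e"] by blast
    have "0 \<le> \<bar>C l\<bar> / e" using e by simp
    then have "real m > 0" using m by linarith
    moreover have "C l < e * real m"
      using m e by (simp add: pos_divide_less_eq mult.commute)
    ultimately have "m > 0" "C l / real m < e"
      by (simp_all add: pos_divide_less_eq)
    have "(INF l\<in>{0<..}. g l) \<le> g (m * l)"
      using l \<open>m > 0\<close> by (intro INF_lower) simp
    also have "\<dots> \<le> f l + ereal (C l / real m)" using assms l \<open>m > 0\<close> by blast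
    also have "\<dots> \<le> f l + ereal e" using \<open>C l / real m < e\<close> by (intro add_left_mono) simp
    finally show "(INF l\<in>{0<..}. g l) \<le> f l + ereal e" .
  qed
qed

text \<open>\<open>L\<close> stands for liminf or limsup, so that both dimensions share one
  computation. Normalising by \<open>m * l\<close> cancels the factor \<open>m\<close> of the
  long-block bound and divides the additive error \<open>d\<close> by \<open>m\<close>.\<close>

lemma entropy_rate_comparison:
  fixes L :: "(nat \<Rightarrow> ereal) \<Rightarrow> ereal" and d :: real
  assumes mono: "\<And>X Y. (\<And>n. X n \<le> Y n) \<Longrightarrow> L X \<le> L Y"
    and add: "\<And>X. L (\<lambda>n. X n + ereal d) = L X + ereal d"
    and mult: "L (\<lambda>n. ereal (emp_entropy (block_seq (m * l) S) n))
      \<le> ereal (real m) * L (\<lambda>n. ereal (emp_entropy (block_seq l S) n))"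
    and le: "\<And>n. emp_entropy (block_seq (m * l) T) n \<le> emp_entropy (block_seq (m * l) S) n + d"
    and "m > 0" "l > 0" "k \<ge> 2"
  shows "ereal (1 / (real (m * l) * log 2 (real k))) * L (\<lambda>n. ereal (emp_entropy (block_seq (m * l) T) n))
    \<le> ereal (1 / (real l * log 2 (real k))) * L (\<lambda>n. ereal (emp_entropy (block_seq l S) n))
      + ereal (d / (real l * log 2 (real k)) / real m)"
proof -
  let ?c = "1 / (real (m * l) * log 2 (real k))"
  let ?E = "\<lambda>l S. L (\<lambda>n. ereal (emp_entropy (block_seq l S) n))"
  have "?E (m * l) T \<le> L (\<lambda>n. ereal (emp_entropy (block_seq (m * l) S) n) + ereal d)"
    using le by (intro mono) simp
  also have "\<dots> \<le> ereal (real m) * ?E l S + ereal d"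
    unfolding add using mult by (rule add_right_mono)
  finally have "ereal ?c * ?E (m * l) T \<le> ereal ?c * (ereal (real m) * ?E l S + ereal d)"
    using assms by (intro ereal_mult_left_mono) simp_all
  also have "\<dots> = ereal (?c * real m) * ?E l S + ereal (?c * d)"
    by (simp add: ereal_distrib_left mult.assoc[symmetric])
  also have "?c * real m = 1 / (real l * log 2 (real k))" using assms by simp
  also have "?c * d = d / (real l * log 2 (real k)) / real m" by simp
  finally show ?thesis .
qed

section \<open>Dimensions under integer linear relations\<close>

lemma fs_dim_le:
  fixes a b c :: int
  assumes k: "k \<ge> 2" and b: "b \<noteq> 0" and rel: "of_int a * x + of_int c = of_int b * y"
  shows "fs_dim k y \<le> fs_dim k x" and "fs_strong_dim k y \<le> fs_strong_dim k x"
proof -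
  let ?S = "base_expansion k x" and ?T = "base_expansion k y"
  \<comment> \<open>The number of pairs of an incoming and an outgoing carry.\<close>
  define D where "D = card ({- (\<bar>a\<bar> + \<bar>b\<bar>)..\<bar>a\<bar> + \<bar>b\<bar>} \<times> {- (\<bar>a\<bar> + \<bar>b\<bar>)..\<bar>a\<bar> + \<bar>b\<bar>})"
  \<comment> \<open>\<open>C l / m\<close> is the cost \<open>log 2 D\<close> of the carries,
    normalised for blocks of length \<open>m * l\<close>.\<close>
  define C where "C l = log 2 (real D) / (real l * log 2 (real k))" for l
  have S: "is_base_expansion k ?S (frac x)" and T: "is_base_expansion k ?T (frac y)"
    unfolding base_expansion_def using someI_ex[OF is_base_expansion_exists[OF k]] by this+
  then have SD: "?S n < k" and TD: "?T n < k" for n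
    by (auto simp: is_base_expansion_def)
  \<comment> \<open>The integer parts of \<open>x\<close> and \<open>y\<close> are absorbed into the
    constant term.\<close>
  have frac_rel: "of_int a * frac x + of_int (c + a * \<lfloor>x\<rfloor> - b * \<lfloor>y\<rfloor>) = of_int b * frac y"
    using rel by (simp add: frac_def algebra_simps)
  have "D \<ge> 1" by (simp add: D_def)
  then have le: "emp_entropy (block_seq l ?T) n \<le> emp_entropy (block_seq l ?S) n + log 2 (real D)"
    for l n
    unfolding D_def by (intro emp_entropy_le_fiber block_fiber_card[OF k b S T frac_rel])
  note entropy = shannon_entropy_block_freq[of ?S k, OF SD] shannon_entropy_block_freq[of ?T k, OF TD]
  have "lower_entropy_rate k (m * l) ?T \<le> lower_entropy_rate k l ?S + ereal (C l / real m)"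
    if "m > 0" "l > 0" for m l
    unfolding lower_entropy_rate_def entropy C_def using that k le
    by (intro entropy_rate_comparison liminf_emp_entropy_long_blocks Liminf_mono always_eventually)
      (auto intro: Liminf_add_ereal_right)
  then show "fs_dim k y \<le> fs_dim k x"
    unfolding fs_dim_def fs_dim_seq_def by (rule INF_le_INF_of_multiples)
  have "upper_entropy_rate k (m * l) ?T \<le> upper_entropy_rate k l ?S + ereal (C l / real m)"
    if "m > 0" "l > 0" for m l
    unfolding upper_entropy_rate_def entropy C_def using that k le
    by (intro entropy_rate_comparison limsup_emp_entropy_long_blocks Limsup_mono always_eventually)
      (auto intro: Limsup_add_ereal_right)
  then show "fs_strong_dim k y \<le> fs_strong_dim k x"
    unfolding fs_strong_dim_def fs_strong_dim_seq_def by (rule INF_le_INF_of_multiples)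
qed

text \<open>The relation can be solved for either number: exchanging \<open>a\<close> with
  \<open>b\<close> and negating \<open>c\<close> gives the reverse inequality.\<close>

lemma fs_dim_eq:
  fixes a b c :: int
  assumes k: "k \<ge> 2" and ab: "a \<noteq> 0" "b \<noteq> 0" and rel: "of_int a * x + of_int c = of_int b * y"
  shows "fs_dim k y = fs_dim k x" and "fs_strong_dim k y = fs_strong_dim k x"
proof -
  have rel': "of_int b * y + of_int (- c) = of_int a * x" using rel by simp
  show "fs_dim k y = fs_dim k x" and "fs_strong_dim k y = fs_strong_dim k x"
    using fs_dim_le[OF k ab(2) rel] fs_dim_le[OF k ab(1) rel'] by (auto intro: antisym)
qed

theorem theorem2:
  fixes k :: nat and q \<alpha> :: real
  assumes "k \<ge> 2" and "q \<in> \<rat>" and "q \<noteq> 0"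
  shows "(fs_dim k (q + \<alpha>) = fs_dim k (q * \<alpha>) \<and>
          fs_dim k (q * \<alpha>) = fs_dim k \<alpha>) \<and>
         (fs_strong_dim k (q + \<alpha>) = fs_strong_dim k (q * \<alpha>) \<and>
          fs_strong_dim k (q * \<alpha>) = fs_strong_dim k \<alpha>)"
proof -
  obtain a b :: int where b: "b > 0" and q: "q = of_int a / of_int b"
    using \<open>q \<in> \<rat>\<close> by (cases q rule: Rats_cases') auto
  with \<open>q \<noteq> 0\<close> have a: "a \<noteq> 0" by auto
  \<comment> \<open>With \<open>q = a / b\<close>, translation and scaling both become integer
    relations, with coefficients \<open>b, a, b\<close> and \<open>a, 0, b\<close>.\<close>
  have add: "of_int b * \<alpha> + of_int a = of_int b * (q + \<alpha>)"
    using b by (simp add: q field_simps)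
  have mult: "of_int a * \<alpha> + of_int 0 = of_int b * (q * \<alpha>)"
    using b by (simp add: q field_simps)
  show ?thesis
    using fs_dim_eq[OF \<open>k \<ge> 2\<close> _ _ add] fs_dim_eq[OF \<open>k \<ge> 2\<close> a _ mult] b by simp
qed

end
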